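(* Let $N\ge 2$, let $H$ be a real Hilbert space, $X=H^N$, $I=\{1,\dots,N\}$, and let $\Gamma\subseteq X$ be a set. Then the following assertions are equivalent: (i) $\Gamma$ is $c$-monotone; (ii) for each $\varnothing\neq K\subsetneq I$, the mapping $A_K$ is monotone; (iii) for each $\varnothing\neq K\subsetneq I$, the mapping $J_{A_K}:S(\Gamma)\to H$ is (single-valued and) firmly nonexpansive. In this case, $$J_{A_1}+\cdots+J_{A_N}=\mathrm{Id}|_{S(\Gamma)},$$ equivalently, $\Gamma$ can be parameterized by $$\Gamma=\{(J_{A_1}s,\ldots,J_{A_N}s)\mid s\in S(\Gamma)\};$$ and, furthermore, for each $\varnothing\neq K\subsetneq I$, $$J_{A_K}=\sum_{i\in K}J_{A_i}.$$
   Context: $H$ is a real Hilbert space with inner product $\langle\cdot,\cdot\rangle$ and norm $\|\cdot\|$; $N\ge 2$ is an integer, $I=\{1,\dots,N\}$, $X=X_1\times\cdots\times X_N$ with every $X_i=H$. The cost function is $c:X\to\mathbb{R}$, $c(x_1,\dots,x_N)=\sum_{1\le i<j\le N}\langle x_i,x_j\rangle$. A set $\Gamma\subseteq X$ is $n$-$c$-monotone if for all $n$ tuples $(x_1^1,\dots,x_N^1),\dots,(x_1^n,\dots,x_N^n)$ in $\Gamma$ and all $N$ permutations $\sigma_1,\dots,\sigma_N\in S_n$, $\sum_{j=1}^n c(x_1^{\sigma_1(j)},\dots,x_N^{\sigma_N(j)})\le\sum_{j=1}^n c(x_1^j,\dots,x_N^j)$. $\Gamma$ is $c$-monotone if it is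 $2$-$c$-monotone. The sum mapping is $S:X\to H$, $S(x_1,\dots,x_N)=\sum_{i\in I}x_i$. For $\varnothing\ne K\subsetneq I$, the set-valued mapping $A_K:H\rightrightarrows H$ is defined through its graph: $\operatorname{gra}A_K=\{(\sum_{i\in K}x_i,\sum_{i\in I\setminus K}x_i)\mid(x_1,\dots,x_N)\in\Gamma\}$; and $A_i=A_{\{i\}}$. A set-valued $A:H\rightrightarrows H$ is monotone if $\langle x-y,u-v\rangle\ge0$ for all $(x,u),(y,v)\in\operatorname{gra}A$. Its resolvent is $J_A=(A+\mathrm{Id})^{-1}$ (inverse as a set-valued mapping); the domain of $J_{A_K}$ is $S(\Gamma)$. A mapping $T:\operatorname{dom}T\subseteq H\to H$ is firmly nonexpansive if $\|Tx-Ty\|^2+\|(\mathrm{Id}-T)x-(\mathrm{Id}-T)y\|^2\le\|x-y\|^2$ for all $x,y\in\operatorname{dom}T$. *)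

theory Defs
  imports "HOL-Analysis.Inner_Product" "HOL-Library.FuncSet" "HOL-Combinatorics.Permutations"
begin

text \<open>A Hilbert space is a type of class \<open>{real_inner, complete_space}\<close>. The index set is
  \<open>{1..N}\<close>, and a point of \<open>X = H^N\<close> is an extensional function on \<open>{1..N}\<close>, so that equality
  of such functions is equality of N-tuples.\<close>

abbreviation tuple_space :: "nat \<Rightarrow> (nat \<Rightarrow> 'a) set"
  where "tuple_space N \<equiv> {1..N} \<rightarrow>\<^sub>E UNIV"

definition cost :: "nat \<Rightarrow> (nat \<Rightarrow> 'a::real_inner) \<Rightarrow> real"
  where "cost N x = (\<Sum>(i, j) \<in> {(i, j). 1 \<le> i \<and> i < j \<and> j \<le> N}. inner (x i) (x j))"

text \<open>Here \<open>x j\<close> is the \<open>j\<close>-th tuple, \<open>x j i\<close> its \<open>i\<close>-th component, and \<open>\<sigma> i\<close> permutes the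
  \<open>i\<close>-th components.\<close>

definition n_c_monotone :: "nat \<Rightarrow> nat \<Rightarrow> (nat \<Rightarrow> 'a::real_inner) set \<Rightarrow> bool"
  where "n_c_monotone n N \<Gamma> \<longleftrightarrow>
    (\<forall>(x :: nat \<Rightarrow> nat \<Rightarrow> 'a) (\<sigma> :: nat \<Rightarrow> nat \<Rightarrow> nat).
      (\<forall>j\<in>{1..n}. x j \<in> \<Gamma>) \<longrightarrow> (\<forall>i\<in>{1..N}. \<sigma> i permutes {1..n}) \<longrightarrow>
      (\<Sum>j=1..n. cost N (\<lambda>i\<in>{1..N}. x (\<sigma> i j) i)) \<le> (\<Sum>j=1..n. cost N (x j)))"

definition c_monotone :: "nat \<Rightarrow> (nat \<Rightarrow> 'a::real_inner) set \<Rightarrow> bool"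
  where "c_monotone N \<Gamma> \<longleftrightarrow> n_c_monotone 2 N \<Gamma>"

definition sum_map :: "nat \<Rightarrow> (nat \<Rightarrow> 'a) \<Rightarrow> 'a::comm_monoid_add"
  where "sum_map N x = (\<Sum>i=1..N. x i)"

text \<open>A set-valued mapping is a function \<open>'a \<Rightarrow> 'a set\<close>.\<close>

definition gra :: "('a \<Rightarrow> 'a set) \<Rightarrow> ('a \<times> 'a) set"
  where "gra A = {(x, u). u \<in> A x}"

definition sv_dom :: "('a \<Rightarrow> 'a set) \<Rightarrow> 'a set"
  where "sv_dom A = {x. A x \<noteq> {}}"

definition sv_inverse :: "('a \<Rightarrow> 'a set) \<Rightarrow> 'a \<Rightarrow> 'a set"
  where "sv_inverse A u = {x. u \<in> A x}"

definition sv_plus :: "('a \<Rightarrow> 'a set) \<Rightarrow> ('a \<Rightarrow> 'a set) \<Rightarrow> 'a::plus \<Rightarrow> 'a set"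
  where "sv_plus A B x = {u + v | u v. u \<in> A x \<and> v \<in> B x}"

definition sv_Id :: "'a \<Rightarrow> 'a set"
  where "sv_Id x = {x}"

definition resolvent :: "('a \<Rightarrow> 'a set) \<Rightarrow> 'a::plus \<Rightarrow> 'a set"
  where "resolvent A = sv_inverse (sv_plus A sv_Id)"

definition monotone_operator :: "('a::real_inner \<Rightarrow> 'a set) \<Rightarrow> bool"
  where "monotone_operator A \<longleftrightarrow>
    (\<forall>(x, u) \<in> gra A. \<forall>(y, v) \<in> gra A. inner (x - y) (u - v) \<ge> 0)"

text \<open>\<open>single_valued_map D A\<close>: the set-valued \<open>A\<close> is a (single-valued) mapping from \<open>D\<close> to
  the whole space. Its value at a point \<open>x\<close> of \<open>D\<close> is then \<open>sv_value A x\<close>; outside \<open>D\<close>,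
  \<open>sv_value\<close> is meaningless.\<close>

definition single_valued_map :: "'a set \<Rightarrow> ('a \<Rightarrow> 'a set) \<Rightarrow> bool"
  where "single_valued_map D A \<longleftrightarrow> sv_dom A = D \<and> (\<forall>x\<in>D. is_singleton (A x))"

definition sv_value :: "('a \<Rightarrow> 'a set) \<Rightarrow> 'a \<Rightarrow> 'a"
  where "sv_value A x = the_elem (A x)"

definition firmly_nonexpansive_on :: "'a::real_inner set \<Rightarrow> ('a \<Rightarrow> 'a) \<Rightarrow> bool"
  where "firmly_nonexpansive_on D T \<longleftrightarrow>
    (\<forall>x\<in>D. \<forall>y\<in>D.
      (norm (T x - T y))\<^sup>2 + (norm ((x - T x) - (y - T y)))\<^sup>2 \<le> (norm (x - y))\<^sup>2)"

definition A_op :: "nat \<Rightarrow> (nat \<Rightarrow> 'a) set \<Rightarrow> nat set \<Rightarrow> 'a::comm_monoid_add \<Rightarrow> 'a set"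
  where "A_op N \<Gamma> K y = {\<Sum>i\<in>{1..N} - K. x i | x. x \<in> \<Gamma> \<and> y = (\<Sum>i\<in>K. x i)}"

lemma gra_A_op: "gra (A_op N \<Gamma> K) = {(\<Sum>i\<in>K. x i, \<Sum>i\<in>{1..N} - K. x i) | x. x \<in> \<Gamma>}"
  unfolding gra_def A_op_def by auto

definition J_op :: "nat \<Rightarrow> (nat \<Rightarrow> 'a) set \<Rightarrow> nat set \<Rightarrow> 'a::comm_monoid_add \<Rightarrow> 'a set"
  where "J_op N \<Gamma> K = resolvent (A_op N \<Gamma> K)"

lemma sv_dom_J_op:
  assumes "K \<subseteq> {1..N}"
  shows "sv_dom (J_op N \<Gamma> K) = sum_map N ` \<Gamma>"
proof -
  have "sum x ({1..N} - K) + sum x K = sum x {1..N}" for x :: "nat \<Rightarrow> 'a"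
    using assms by (metis finite_atLeastAtMost sum.subset_diff)
  then show ?thesis
    unfolding sv_dom_def J_op_def resolvent_def sv_inverse_def sv_plus_def sv_Id_def A_op_def
      sum_map_def by (auto simp: image_iff) metis+
qed

end

theory Submission
  imports Defs
begin

text \<open>
  Since \<open>2 c(x) = \<parallel>S x\<parallel>\<^sup>2 - \<Sum>\<^sub>i \<parallel>x\<^sub>i\<parallel>\<^sup>2\<close> (\<open>norm_sum_map_squared\<close>), shuffling the components of
  several tuples changes the total cost only through the norms of their sums. A shuffle of two
  tuples \<open>x\<close>, \<open>y\<close> amounts to choosing the set \<open>K\<close> of positions left in place. With
  \<open>a = \<Sum>\<^sub>K x\<^sub>i\<close>, \<open>a' = \<Sum>\<^bsub>I - K\<^esub> x\<^sub>i\<close> and likewise \<open>b\<close>, \<open>b'\<close> for \<open>y\<close>, the cost lost by the shuffle is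
  half of
  \<open>\<parallel>a + a'\<parallel>\<^sup>2 + \<parallel>b + b'\<parallel>\<^sup>2 - \<parallel>a + b'\<parallel>\<^sup>2 - \<parallel>b + a'\<parallel>\<^sup>2 = 2 \<langle>a - b, a' - b'\<rangle>\<close>,
  so its nonnegativity for all \<open>x\<close>, \<open>y\<close> in \<open>\<Gamma>\<close> is exactly monotonicity of \<open>A\<^sub>K\<close>
  (\<open>cost_exchange\<close>, \<open>c_monotone_iff_exchange\<close>). The trivial choices \<open>K = \<emptyset>\<close> and \<open>K = I\<close> lose
  nothing, which is why only proper nonempty \<open>K\<close> appear.

  The passage from monotone mappings to firmly nonexpansive resolvents is Minty's observation
  (\<open>monotone_iff_resolvent_firmly_nonexpansive\<close>), valid for every set-valued mapping. Finally, a
  point \<open>x\<close> of \<open>\<Gamma>\<close> witnesses that \<open>\<Sum>\<^sub>K x\<^sub>i\<close> is a value of the resolvent of \<open>A\<^sub>K\<close> at \<open>S x\<close>; once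
  this resolvent is single-valued, it is the value, and the three formulas for the resolvents
  are read off from it.
\<close>

section \<open>The cost of exchanging components\<close>

lemma cost_Suc:
  "cost (Suc N) x = cost N x + inner (sum_map N x) (x (Suc N))"
proof -
  let ?P = "\<lambda>N. {(i, j). 1 \<le> i \<and> i < j \<and> j \<le> N} :: (nat \<times> nat) set"
  have split: "?P (Suc N) = ?P N \<union> (\<lambda>i. (i, Suc N)) ` {1..N}"
    by (auto simp: le_Suc_eq)
  have "finite (?P N)"
    by (rule finite_subset[of _ "{1..N} \<times> {1..N}"]) auto
  then have "cost (Suc N) x =
      cost N x + (\<Sum>(i, j) \<in> (\<lambda>i. (i, Suc N)) ` {1..N}. inner (x i) (x j))"
    unfolding cost_def split by (intro sum.union_disjoint) auto
  also have "(\<Sum>(i, j) \<in> (\<lambda>i. (i, Suc N)) ` {1..N}. inner (x i) (x j))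
      = inner (sum_map N x) (x (Suc N))"
    by (subst sum.reindex) (auto simp: inj_on_def sum_map_def inner_sum_left)
  finally show ?thesis .
qed

lemma norm_sum_map_squared:
  "(norm (sum_map N x))\<^sup>2 = (\<Sum>i=1..N. (norm (x i))\<^sup>2) + 2 * cost N x"
proof (induction N)
  case 0
  have no_pairs: "{(i, j). 1 \<le> i \<and> i < j \<and> j \<le> 0} = ({} :: (nat \<times> nat) set)"
    by auto
  show ?case
    unfolding cost_def no_pairs by (simp add: sum_map_def)
next
  case (Suc N)
  have "sum_map (Suc N) x = sum_map N x + x (Suc N)"
    by (simp add: sum_map_def)
  then have "(norm (sum_map (Suc N) x))\<^sup>2 =
      (norm (sum_map N x))\<^sup>2 + 2 * inner (sum_map N x) (x (Suc N)) + (norm (x (Suc N)))\<^sup>2"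
    by (simp add: power2_norm_eq_inner inner_add_left inner_add_right inner_commute)
  then show ?case
    using Suc.IH cost_Suc[of N x] by simp
qed

definition exchange :: "nat \<Rightarrow> nat set \<Rightarrow> (nat \<Rightarrow> 'a) \<Rightarrow> (nat \<Rightarrow> 'a) \<Rightarrow> nat \<Rightarrow> 'a"
  where "exchange N K x y = (\<lambda>i\<in>{1..N}. if i \<in> K then x i else y i)"

lemma sum_map_split:
  assumes "K \<subseteq> {1..N}"
  shows "sum_map N x = sum x K + sum x ({1..N} - K)"
  unfolding sum_map_def using assms by (metis add.commute finite_atLeastAtMost sum.subset_diff)

lemma sum_map_exchange:
  assumes "K \<subseteq> {1..N}"
  shows "sum_map N (exchange N K x y) = sum x K + sum y ({1..N} - K)"
proof -
  have "sum (exchange N K x y) K = sum x K"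
    using assms by (intro sum.cong) (auto simp: exchange_def)
  moreover have "sum (exchange N K x y) ({1..N} - K) = sum y ({1..N} - K)"
    by (intro sum.cong) (auto simp: exchange_def)
  ultimately show ?thesis
    using sum_map_split[OF assms, of "exchange N K x y"] by simp
qed

text \<open>An exchange only moves components from one tuple to the other, so the squared norms of the
  components cancel and only the squared norms of the sums remain.\<close>

lemma cost_exchange:
  assumes "K \<subseteq> {1..N}"
  shows "cost N x + cost N y - (cost N (exchange N K x y) + cost N (exchange N K y x)) =
    inner (sum x K - sum y K) (sum x ({1..N} - K) - sum y ({1..N} - K))"
proof -
  let ?a = "sum x K" and ?a' = "sum x ({1..N} - K)"
  let ?b = "sum y K" and ?b' = "sum y ({1..N} - K)"
  have "(\<Sum>i=1..N. (norm (exchange N K x y i))\<^sup>2) + (\<Sum>i=1..N. (norm (exchange N K y x i))\<^sup>2)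
      = (\<Sum>i=1..N. (norm (x i))\<^sup>2) + (\<Sum>i=1..N. (norm (y i))\<^sup>2)"
    unfolding sum.distrib[symmetric] by (intro sum.cong) (auto simp: exchange_def)
  then have "2 * (cost N x + cost N y - (cost N (exchange N K x y) + cost N (exchange N K y x)))
      = (norm (sum_map N x))\<^sup>2 + (norm (sum_map N y))\<^sup>2
        - ((norm (sum_map N (exchange N K x y)))\<^sup>2 + (norm (sum_map N (exchange N K y x)))\<^sup>2)"
    unfolding norm_sum_map_squared by argo
  also have "\<dots> = (norm (?a + ?a'))\<^sup>2 + (norm (?b + ?b'))\<^sup>2
        - ((norm (?a + ?b'))\<^sup>2 + (norm (?b + ?a'))\<^sup>2)"
    unfolding sum_map_exchange[OF assms] by (simp only: sum_map_split[OF assms])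
  also have "\<dots> = 2 * inner (?a - ?b) (?a' - ?b')"
    by (simp add: power2_norm_eq_inner inner_simps inner_commute)
  finally show ?thesis
    by simp
qed

section \<open>Monotonicity as stability under exchange\<close>

text \<open>A permutation of two indices is the identity or the swap, so a family of \<open>N\<close> of them
  carries the same information as the set \<open>K\<close> of positions where it is the identity.\<close>

lemma c_monotone_iff_exchange:
  "c_monotone N \<Gamma> \<longleftrightarrow>
    (\<forall>K. K \<subseteq> {1..N} \<longrightarrow> (\<forall>x\<in>\<Gamma>. \<forall>y\<in>\<Gamma>.
      cost N (exchange N K x y) + cost N (exchange N K y x) \<le> cost N x + cost N y))"
    (is "_ \<longleftrightarrow> ?exch")
proof
  have two: "{1..2} = {1, 2 :: nat}"
    by auto
  have sum_two: "(\<Sum>j=1..2. f j) = f 1 + f 2" for f :: "nat \<Rightarrow> real"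
    unfolding two by simp
  show ?exch if mono: "c_monotone N \<Gamma>"
  proof (intro allI impI ballI)
    fix K x y assume "K \<subseteq> {1..N}" and x: "x \<in> \<Gamma>" and y: "y \<in> \<Gamma>"
    define t where "t = (\<lambda>j::nat. if j = 1 then x else y)"
    define \<sigma> where "\<sigma> = (\<lambda>i. if i \<in> K then id else transpose 1 (2::nat))"
    have "\<forall>j\<in>{1..2}. t j \<in> \<Gamma>"
      using x y by (simp add: t_def)
    moreover have "\<forall>i\<in>{1..N}. \<sigma> i permutes {1..2}"
      by (auto simp: \<sigma>_def permutes_id intro: permutes_swap_id)
    ultimately have "(\<Sum>j=1..2. cost N (\<lambda>i\<in>{1..N}. t (\<sigma> i j) i)) \<le> (\<Sum>j=1..2. cost N (t j))"
      using mono unfolding c_monotone_def n_c_monotone_def by blast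
    moreover have "(\<lambda>i\<in>{1..N}. t (\<sigma> i 1) i) = exchange N K x y"
      unfolding exchange_def by (intro restrict_ext) (simp add: t_def \<sigma>_def)
    moreover have "(\<lambda>i\<in>{1..N}. t (\<sigma> i 2) i) = exchange N K y x"
      unfolding exchange_def by (intro restrict_ext) (simp add: t_def \<sigma>_def)
    ultimately show "cost N (exchange N K x y) + cost N (exchange N K y x) \<le> cost N x + cost N y"
      unfolding sum_two by (simp add: t_def)
  qed
  show "c_monotone N \<Gamma>" if exch: ?exch
    unfolding c_monotone_def n_c_monotone_def
  proof (intro allI impI)
    fix t :: "nat \<Rightarrow> nat \<Rightarrow> 'a" and \<sigma> :: "nat \<Rightarrow> nat \<Rightarrow> nat"
    assume t: "\<forall>j\<in>{1..2}. t j \<in> \<Gamma>" and \<sigma>: "\<forall>i\<in>{1..N}. \<sigma> i permutes {1..2}"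
    define K where "K = {i \<in> {1..N}. \<sigma> i 1 = 1}"
    have vals: "\<sigma> i 1 = (if i \<in> K then 1 else 2)" "\<sigma> i 2 = (if i \<in> K then 2 else 1)"
      if "i \<in> {1..N}" for i
    proof -
      have perm: "\<sigma> i permutes {1..2}"
        using \<sigma> that by blast
      have "\<sigma> i 1 \<in> {1, 2}" "\<sigma> i 2 \<in> {1, 2}"
        using permutes_in_image[OF perm, of 1] permutes_in_image[OF perm, of 2] unfolding two
        by simp_all
      moreover have "\<sigma> i 1 \<noteq> \<sigma> i 2"
        using inj_eq[OF permutes_inj[OF perm], of 1 2] by simp
      ultimately show "\<sigma> i 1 = (if i \<in> K then 1 else 2)" "\<sigma> i 2 = (if i \<in> K then 2 else 1)"
        using that by (auto simp: K_def)
    qed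
    have "(\<lambda>i\<in>{1..N}. t (\<sigma> i 1) i) = exchange N K (t 1) (t 2)"
      unfolding exchange_def by (intro restrict_ext) (simp add: vals del: One_nat_def)
    moreover have "(\<lambda>i\<in>{1..N}. t (\<sigma> i 2) i) = exchange N K (t 2) (t 1)"
      unfolding exchange_def by (intro restrict_ext) (simp add: vals del: One_nat_def)
    moreover have "cost N (exchange N K (t 1) (t 2)) + cost N (exchange N K (t 2) (t 1))
        \<le> cost N (t 1) + cost N (t 2)"
    proof -
      have "K \<subseteq> {1..N}" "t 1 \<in> \<Gamma>" "t 2 \<in> \<Gamma>"
        using t unfolding two by (auto simp: K_def)
      then show ?thesis
        using exch by blast
    qed
    ultimately show "(\<Sum>j=1..2. cost N (\<lambda>i\<in>{1..N}. t (\<sigma> i j) i)) \<le> (\<Sum>j=1..2. cost N (t j))"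
      unfolding sum_two by simp
  qed
qed

lemma monotone_A_op_iff:
  "monotone_operator (A_op N \<Gamma> K) \<longleftrightarrow>
    (\<forall>x\<in>\<Gamma>. \<forall>y\<in>\<Gamma>.
      inner (sum x K - sum y K) (sum x ({1..N} - K) - sum y ({1..N} - K)) \<ge> 0)"
  unfolding monotone_operator_def gra_A_op by blast

lemma c_monotone_iff_monotone_A_op:
  "c_monotone N \<Gamma> \<longleftrightarrow>
    (\<forall>K. K \<noteq> {} \<and> K \<subset> {1..N} \<longrightarrow> monotone_operator (A_op N \<Gamma> K))"
proof -
  have "c_monotone N \<Gamma> \<longleftrightarrow> (\<forall>K. K \<subseteq> {1..N} \<longrightarrow> monotone_operator (A_op N \<Gamma> K))"
    unfolding c_monotone_iff_exchange monotone_A_op_iff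
    by (simp only: cost_exchange[symmetric] diff_ge_0_iff_ge cong: imp_cong)
  moreover have "monotone_operator (A_op N \<Gamma> {})" "monotone_operator (A_op N \<Gamma> {1..N})"
    by (simp_all add: monotone_A_op_iff)
  ultimately show ?thesis
    by (metis psubsetI psubset_imp_subset)
qed

section \<open>Resolvents of monotone mappings\<close>

lemma resolvent_iff: "p \<in> resolvent A s \<longleftrightarrow> (p, s - p) \<in> gra A" for s :: "'a::ab_group_add"
  unfolding resolvent_def sv_inverse_def sv_plus_def sv_Id_def gra_def
  by (auto simp: algebra_simps) (metis add_diff_cancel_left' diff_add_cancel)

lemma sv_value_eqI:
  assumes "single_valued_map D A" and "p \<in> A s"
  shows "sv_value A s = p"
proof -
  have "s \<in> sv_dom A"
    using assms(2) by (auto simp: sv_dom_def)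
  then have "is_singleton (A s)"
    using assms(1) by (simp add: single_valued_map_def)
  then show ?thesis
    using assms(2) by (auto simp: sv_value_def is_singleton_def)
qed

text \<open>For pairs \<open>(x, u)\<close>, \<open>(y, v)\<close> of the graph of \<open>A\<close>, the points \<open>x + u\<close>, \<open>y + v\<close> have resolvent
  values \<open>x\<close>, \<open>y\<close>, and the slack in the inequality of firm nonexpansiveness is
  \<open>\<parallel>(x - y) + (u - v)\<parallel>\<^sup>2 - \<parallel>x - y\<parallel>\<^sup>2 - \<parallel>u - v\<parallel>\<^sup>2 = 2 \<langle>x - y, u - v\<rangle>\<close>.
  Single-valuedness is the case \<open>x + u = y + v\<close>, where the inner product is
  \<open>-\<parallel>x - y\<parallel>\<^sup>2\<close>.\<close>

lemma monotone_iff_resolvent_firmly_nonexpansive: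
  fixes A :: "'a::real_inner \<Rightarrow> 'a set"
  defines "D \<equiv> sv_dom (resolvent A)"
  shows "monotone_operator A \<longleftrightarrow>
    single_valued_map D (resolvent A) \<and> firmly_nonexpansive_on D (sv_value (resolvent A))"
    (is "_ \<longleftrightarrow> ?sv \<and> ?fne")
proof -
  have slack: "(norm p)\<^sup>2 + (norm q)\<^sup>2 \<le> (norm (p + q))\<^sup>2 \<longleftrightarrow> inner p q \<ge> 0" for p q :: 'a
    by (simp add: power2_norm_eq_inner inner_simps inner_commute)
  have sv: ?sv if mono: "monotone_operator A"
  proof -
    have "p = q" if "p \<in> resolvent A s" "q \<in> resolvent A s" for p q s
    proof -
      have "inner (p - q) ((s - p) - (s - q)) \<ge> 0"
        using mono that unfolding monotone_operator_def resolvent_iff by blast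
      moreover have "(s - p) - (s - q) = - (p - q)"
        by simp
      ultimately have "inner (p - q) (p - q) \<le> 0"
        by (simp only: inner_minus_right neg_0_le_iff_le)
      then show "p = q"
        by (metis eq_iff_diff_eq_0 inner_gt_zero_iff not_less)
    qed
    then show ?thesis
      by (auto simp: single_valued_map_def D_def sv_dom_def intro!: is_singletonI')
  qed
  have "monotone_operator A \<longleftrightarrow> ?fne" if sv: ?sv
  proof
    show ?fne if mono: "monotone_operator A"
      unfolding firmly_nonexpansive_on_def
    proof (intro ballI)
      fix s t assume "s \<in> D" "t \<in> D"
      then obtain p q where "p \<in> resolvent A s" "q \<in> resolvent A t"
        by (auto simp: D_def sv_dom_def)
      moreover from this have "inner (p - q) ((s - p) - (t - q)) \<ge> 0"
        using mono unfolding monotone_operator_def resolvent_iff by blast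
      ultimately show "(norm (sv_value (resolvent A) s - sv_value (resolvent A) t))\<^sup>2
          + (norm ((s - sv_value (resolvent A) s) - (t - sv_value (resolvent A) t)))\<^sup>2
          \<le> (norm (s - t))\<^sup>2"
        using slack[of "p - q" "(s - p) - (t - q)"] by (simp add: sv_value_eqI[OF sv])
    qed
    show "monotone_operator A" if fne: ?fne
    proof -
      have "inner (x - y) (u - v) \<ge> 0" if "(x, u) \<in> gra A" "(y, v) \<in> gra A" for x u y v
      proof -
        have x: "x \<in> resolvent A (x + u)" and y: "y \<in> resolvent A (y + v)"
          using that by (simp_all add: resolvent_iff)
        then have "x + u \<in> D" "y + v \<in> D"
          by (auto simp: D_def sv_dom_def)
        then have "(norm (x - y))\<^sup>2 + (norm (u - v))\<^sup>2 \<le> (norm ((x + u) - (y + v)))\<^sup>2"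
          using fne sv_value_eqI[OF sv x] sv_value_eqI[OF sv y]
          unfolding firmly_nonexpansive_on_def by fastforce
        moreover have "(x + u) - (y + v) = (x - y) + (u - v)"
          by simp
        ultimately show ?thesis
          by (simp only: slack)
      qed
      then show ?thesis
        unfolding monotone_operator_def by blast
    qed
  qed
  with sv show ?thesis
    by blast
qed

section \<open>The equivalence and the parameterization\<close>

lemma sum_in_J_op:
  fixes x :: "nat \<Rightarrow> 'a::ab_group_add"
  assumes "K \<subseteq> {1..N}" and "x \<in> \<Gamma>"
  shows "sum x K \<in> J_op N \<Gamma> K (sum_map N x)"
  using assms(2) unfolding J_op_def resolvent_iff gra_A_op by (auto simp: sum_map_split[OF assms(1)])

theorem lemma2p3:
  fixes N :: nat and \<Gamma> :: "(nat \<Rightarrow> 'a::{real_inner, complete_space}) set"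
  assumes "N \<ge> 2" and "\<Gamma> \<subseteq> tuple_space N"
  shows
    "(c_monotone N \<Gamma> \<longleftrightarrow>
        (\<forall>K. K \<noteq> {} \<and> K \<subset> {1..N} \<longrightarrow> monotone_operator (A_op N \<Gamma> K))) \<and>
     (c_monotone N \<Gamma> \<longleftrightarrow>
        (\<forall>K. K \<noteq> {} \<and> K \<subset> {1..N} \<longrightarrow>
          single_valued_map (sum_map N ` \<Gamma>) (J_op N \<Gamma> K) \<and>
          firmly_nonexpansive_on (sum_map N ` \<Gamma>) (sv_value (J_op N \<Gamma> K)))) \<and>
     (c_monotone N \<Gamma> \<longrightarrow>
        (\<forall>s \<in> sum_map N ` \<Gamma>. (\<Sum>i=1..N. sv_value (J_op N \<Gamma> {i}) s) = s) \<and>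
        \<Gamma> = {(\<lambda>i\<in>{1..N}. sv_value (J_op N \<Gamma> {i}) s) | s. s \<in> sum_map N ` \<Gamma>} \<and>
        (\<forall>K. K \<noteq> {} \<and> K \<subset> {1..N} \<longrightarrow>
          (\<forall>s \<in> sum_map N ` \<Gamma>. sv_value (J_op N \<Gamma> K) s = (\<Sum>i\<in>K. sv_value (J_op N \<Gamma> {i}) s))))"
proof -
  let ?D = "sum_map N ` \<Gamma>"
  let ?J = "\<lambda>K. sv_value (J_op N \<Gamma> K)"
  have minty: "monotone_operator (A_op N \<Gamma> K) \<longleftrightarrow>
      single_valued_map ?D (J_op N \<Gamma> K) \<and> firmly_nonexpansive_on ?D (?J K)"
    if "K \<subset> {1..N}" for K
  proof -
    have "sv_dom (resolvent (A_op N \<Gamma> K)) = ?D"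
      using sv_dom_J_op that unfolding J_op_def by blast
    then show ?thesis
      using monotone_iff_resolvent_firmly_nonexpansive[of "A_op N \<Gamma> K"] by (simp add: J_op_def)
  qed
  have formulas: "(\<forall>s \<in> ?D. (\<Sum>i=1..N. ?J {i} s) = s) \<and>
      \<Gamma> = {(\<lambda>i\<in>{1..N}. ?J {i} s) | s. s \<in> ?D} \<and>
      (\<forall>K. K \<noteq> {} \<and> K \<subset> {1..N} \<longrightarrow> (\<forall>s \<in> ?D. ?J K s = (\<Sum>i\<in>K. ?J {i} s)))"
    if mono: "c_monotone N \<Gamma>"
  proof -
    have J: "?J K (sum_map N x) = sum x K" if "K \<noteq> {}" "K \<subset> {1..N}" "x \<in> \<Gamma>" for K x
    proof (rule sv_value_eqI)
      show "single_valued_map ?D (J_op N \<Gamma> K)"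
        using mono minty that unfolding c_monotone_iff_monotone_A_op by blast
      show "sum x K \<in> J_op N \<Gamma> K (sum_map N x)"
        using that by (intro sum_in_J_op) auto
    qed
    have J1: "?J {i} (sum_map N x) = x i" if "i \<in> {1..N}" "x \<in> \<Gamma>" for i x
    proof -
      have "1 \<in> {1..N}" "2 \<in> {1..N}" "(1::nat) \<noteq> 2"
        using assms(1) by auto
      then have "{i} \<noteq> {1..N}"
        by (metis singletonD)
      then have "{i} \<subset> {1..N}"
        using that by blast
      then show ?thesis
        using J[of "{i}" x] that by simp
    qed
    have param: "(\<lambda>i\<in>{1..N}. ?J {i} (sum_map N x)) = x" if "x \<in> \<Gamma>" for x
    proof -
      have "x \<in> extensional {1..N}"
        using that assms(2) by (auto simp: PiE_def)
      then show ?thesis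
        using that J1 by (intro extensionalityI[of _ "{1..N}"]) auto
    qed
    have "\<Gamma> = (\<lambda>x. \<lambda>i\<in>{1..N}. ?J {i} (sum_map N x)) ` \<Gamma>"
      using param by simp
    then have "\<Gamma> = {(\<lambda>i\<in>{1..N}. ?J {i} s) | s. s \<in> ?D}"
      by blast
    moreover have "(\<Sum>i=1..N. ?J {i} s) = s" if s: "s \<in> ?D" for s
    proof -
      obtain x where x: "x \<in> \<Gamma>" "s = sum_map N x"
        using s by blast
      have "(\<Sum>i=1..N. ?J {i} s) = sum x {1..N}"
        using x J1 by (intro sum.cong) auto
      then show ?thesis
        using x by (simp add: sum_map_def)
    qed
    moreover have "?J K s = (\<Sum>i\<in>K. ?J {i} s)"
      if "K \<noteq> {}" "K \<subset> {1..N}" and s: "s \<in> ?D" for K s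
    proof -
      obtain x where x: "x \<in> \<Gamma>" "s = sum_map N x"
        using s by blast
      have "(\<Sum>i\<in>K. ?J {i} s) = sum x K"
        using that x J1 by (intro sum.cong) auto
      then show ?thesis
        using J that x by simp
    qed
    ultimately show ?thesis
      by blast
  qed
  have firm: "c_monotone N \<Gamma> \<longleftrightarrow>
      (\<forall>K. K \<noteq> {} \<and> K \<subset> {1..N} \<longrightarrow>
        single_valued_map ?D (J_op N \<Gamma> K) \<and> firmly_nonexpansive_on ?D (?J K))"
    unfolding c_monotone_iff_monotone_A_op by (intro iff_allI imp_cong refl minty) blast
  show ?thesis
    by (intro conjI[OF c_monotone_iff_monotone_A_op conjI[OF firm]] impI formulas)
qed

end
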